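(* Let $u^0,u^1,u^2\in\mathbb{R}$ with $(u^0)^2+(u^1)^2+(u^2)^2=1$, let $$R^{\lambda\alpha}_{\beta\mu}=u^0\,\delta^\lambda_\mu\delta^\alpha_\beta+\mathrm{i}\,(J^+_1)^\lambda_\mu\,(u^1J^+_1+u^2J^+_2)^\alpha_\beta,\qquad \lambda,\mu,\alpha,\beta\in\{0,1,2,3\},$$ and let $\mathcal{A}(\mathbb{S}^7_R)$ be the corresponding noncommutative seven-sphere $*$-algebra, with hermitian generators $x_1^\lambda,x_2^\alpha$, and with elements $Y^0,Y^1,Y^2,Y^3$ defined by $\sum_{\mu=0}^3Y^\mu e_\mu=2\,x_2x_1^*$. Then $Y^{\mu*}=\Lambda^\mu{}_\nu Y^\nu$ for $\mu=0,1,2,3$, where $\Lambda\in \mathbb{M}_4(\mathbb{C})$ is a symmetric unitary matrix given explicitly by $$\begin{pmatrix}Y^{0*}\\ Y^{3*}\end{pmatrix}=\begin{pmatrix}u^0+\mathrm{i}u^1&\mathrm{i}u^2\\ \mathrm{i}u^2&u^0-\mathrm{i}u^1\end{pmatrix}\begin{pmatrix}Y^0\\ Y^3\end{pmatrix}$$ and $$\begin{pmatrix}Y^{1*}\\ Y^{2*}\end{pmatrix}=\begin{pmatrix}u^0+\mathrm{i}u^1&\mathrm{i}u^2\\ \mathrm{i}u^2&u^0-\mathrm{i}u^1\end{pmatrix}\begin{pmatrix}Y^1\\ Y^2\end{pmatrix}.$$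
   Context: Repeated up-down indices are summed; all algebras are unital associative over $\mathbb{C}$. **Quaternions and the matrices $J^+_a$.** $\mathbb{H}$ has real basis $e_0=1,e_1,e_2,e_3$ with $e_ae_b=-\delta_{ab}+\sum_{c=1}^3\varepsilon_{abc}e_c$ for $a,b\in\{1,2,3\}$, and is identified with $\mathbb{R}^4$ via $q=\sum_\mu x^\mu e_\mu\mapsto(x^0,x^1,x^2,x^3)$. For $a=1,2,3$, $J^+_a$ is the real antisymmetric $4\times4$ matrix of left multiplication $q\mapsto e_aq$, so that $J^+_aJ^+_b=-\delta_{ab}1+\sum_{c}\varepsilon_{abc}J^+_c$; $(J^+_a)^\lambda_\mu$ denotes its entry in row $\lambda$, column $\mu$. **Algebras.** $\mathcal{A}_R$ is the $*$-algebra generated by hermitian elements $x_1^\lambda,x_2^\alpha$ ($\lambda,\alpha\in\{0,1,2,3\}$) with relations $$x_1^\lambda x_1^\mu=x_1^\mu x_1^\lambda,\qquad x_2^\alpha x_2^\beta=x_2^\beta x_2^\alpha,\qquad x_1^\lambda x_2^\alpha=R^{\lambda\alpha}_{\beta\mu}\,x_2^\beta x_1^\mu$$ (and hence, taking adjoints, $x_2^\alpha x_1^\lambda=\overline{R}^{\lambda\alpha}_{\beta\mu}x_1^\mu x_2^\beta$ with $\overline{R}$ the complex conjugate coefficients). The elements $(x_1)^2=\sum_\lambda(x_1^\lambda)^2$ and $(x_2)^2=\sum_\alpha(x_2^\alpha)^2$ are central, and $\mathcal{A}(\mathbb{S}^7_R)=\mathcal{A}_R/\big((x_1)^2+(x_2)^2-1\big)$.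 **The elements $Y^\mu$.** Put $x_1=\sum_\mu x_1^\mu e_\mu$, $x_2=\sum_\alpha x_2^\alpha e_\alpha$ (quaternions with entries in $\mathcal{A}(\mathbb{S}^7_R)$, the $e_\mu$ commuting with the entries). The $*$ of such a quaternion is quaternionic conjugation ($e_0^*=e_0$, $e_k^*=-e_k$) combined with the algebra $*$ on entries, so $x_1^*=x_1^0e_0-\sum_{k=1}^3x_1^ke_k$. The $Y^\mu\in\mathcal{A}(\mathbb{S}^7_R)$ are the components of $2x_2x_1^*$, and $Y^{\mu*}$ is the adjoint of the element $Y^\mu$ in the $*$-algebra $\mathcal{A}(\mathbb{S}^7_R)$. *)

theory Defs
  imports
    "HOL-Analysis.Analysis"
    "HOL-Algebra.QuotRing"
    "HOL-Algebra.Module"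
    "HOL-Library.Poly_Mapping"
begin

text \<open>
  The index set \<open>{0, 1, 2, 3}\<close> is the numeral type \<open>4\<close>, in which \<open>4 = 0\<close>.
  For a matrix \<open>M\<close>, the entry \<open>M $ \<kappa> $ \<mu>\<close> is the one in row \<open>\<kappa>\<close> and column \<open>\<mu>\<close>.
\<close>

section \<open>Quaternions\<close>

definition eps :: "4 \<Rightarrow> 4 \<Rightarrow> 4 \<Rightarrow> real" where
  "eps a b c =
     (if (a, b, c) \<in> {(1, 2, 3), (2, 3, 1), (3, 1, 2)} then 1
      else if (a, b, c) \<in> {(1, 3, 2), (3, 2, 1), (2, 1, 3)} then - 1 else 0)"

text \<open>\<open>quat_coeff \<mu> \<nu> \<rho>\<close> is the coefficient of \<open>e\<^sub>\<rho>\<close> in the product \<open>e\<^sub>\<mu> e\<^sub>\<nu>\<close>.\<close>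

definition quat_coeff :: "4 \<Rightarrow> 4 \<Rightarrow> 4 \<Rightarrow> real" where
  "quat_coeff \<mu> \<nu> \<rho> =
     (if \<mu> = 0 then of_bool (\<rho> = \<nu>)
      else if \<nu> = 0 then of_bool (\<rho> = \<mu>)
      else if \<rho> = 0 then - of_bool (\<mu> = \<nu>)
      else eps \<mu> \<nu> \<rho>)"

definition quat_mult :: "real^4 \<Rightarrow> real^4 \<Rightarrow> real^4" where
  "quat_mult p q = (\<chi> \<rho>. \<Sum>\<mu>\<in>UNIV. \<Sum>\<nu>\<in>UNIV. quat_coeff \<mu> \<nu> \<rho> * (p $ \<mu>) * (q $ \<nu>))"

definition J_plus :: "4 \<Rightarrow> real^4^4" where
  "J_plus a = matrix (\<lambda>q. quat_mult (axis a 1) q)"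


section \<open>Star-algebras and their quotients\<close>

record 'a star_algebra = "(complex, 'a) module" +
  star :: "'a \<Rightarrow> 'a"

text \<open>
  The two-sided ideal generated by \<open>S\<close> and the adjoints of its elements, and the quotient
  by it, whose elements are cosets.  On cosets, \<open>smult\<close> follows the pattern of
  \<^const>\<open>rcoset_mult\<close>; the image of a coset under the involution is a coset, since the
  ideal is closed under the involution.
\<close>

definition star_ideal :: "('a, 'm) star_algebra_scheme \<Rightarrow> 'a set \<Rightarrow> 'a set" where
  "star_ideal A S = Idl\<^bsub>A\<^esub> (S \<union> star A ` S)"

definition star_quot :: "('a, 'm) star_algebra_scheme \<Rightarrow> 'a set \<Rightarrow> 'a set star_algebra" where
  "star_quot A S =
     \<lparr>carrier = carrier (A Quot star_ideal A S),
      mult = mult (A Quot star_ideal A S),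
      one = one (A Quot star_ideal A S),
      zero = zero (A Quot star_ideal A S),
      add = add (A Quot star_ideal A S),
      smult = (\<lambda>c X. \<Union>a\<in>X. star_ideal A S +>\<^bsub>A\<^esub> (c \<odot>\<^bsub>A\<^esub> a)),
      star = (\<lambda>X. star A ` X)\<rparr>"

definition star_proj :: "('a, 'm) star_algebra_scheme \<Rightarrow> 'a set \<Rightarrow> 'a \<Rightarrow> 'a set" where
  "star_proj A S a = star_ideal A S +>\<^bsub>A\<^esub> a"


section \<open>The free star-algebra on hermitian generators\<close>

text \<open>
  The free algebra is the monoid algebra of the words, i.e.\ \<open>'g word \<Rightarrow>\<^sub>0 complex\<close> with the
  convolution product of \<^theory>\<open>HOL-Library.Poly_Mapping\<close>.
\<close>

datatype 'g word = Word (letters: "'g list")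

instantiation word :: (type) monoid_add
begin
definition "0 = Word []"
definition "v + w = Word (letters v @ letters w)"
instance
  by standard (simp_all add: zero_word_def plus_word_def)
end

definition word_rev :: "'g word \<Rightarrow> 'g word" where
  "word_rev w = Word (rev (letters w))"

type_synonym 'g free_elem = "'g word \<Rightarrow>\<^sub>0 complex"

definition free_star_algebra :: "'g free_elem star_algebra" where
  "free_star_algebra =
     \<lparr>carrier = UNIV, mult = (*), one = 1, zero = 0, add = (+),
      smult = (\<lambda>c f. Poly_Mapping.map ((*) c) f),
      star = (\<lambda>f. Poly_Mapping.map cnj (Poly_Mapping.map_key word_rev f))\<rparr>"

definition free_gen :: "'g \<Rightarrow> 'g free_elem" where
  "free_gen g = Poly_Mapping.single (Word [g]) 1"


section \<open>The noncommutative seven-sphere\<close>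

datatype gen = X1 4 | X2 4

text \<open>A tensor \<open>R :: 4 \<Rightarrow> 4 \<Rightarrow> 4 \<Rightarrow> 4 \<Rightarrow> complex\<close> has its arguments in the order
  \<open>R \<kappa> \<alpha> \<beta> \<mu>\<close>, upper indices first.
  The adjoint relations for \<open>x\<^sub>2\<^sup>\<alpha> x\<^sub>1\<^sup>\<kappa>\<close> are not listed, since \<^const>\<open>star_quot\<close> also divides out
  the adjoints of the given relations.\<close>

definition R_relations :: "(4 \<Rightarrow> 4 \<Rightarrow> 4 \<Rightarrow> 4 \<Rightarrow> complex) \<Rightarrow> gen free_elem set" where
  "R_relations R = (let x1 = (\<lambda>\<kappa>. free_gen (X1 \<kappa>)); x2 = (\<lambda>\<alpha>. free_gen (X2 \<alpha>)) in
     {x1 \<kappa> * x1 \<mu> - x1 \<mu> * x1 \<kappa> | \<kappa> \<mu>. True} \<union>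
     {x2 \<alpha> * x2 \<beta> - x2 \<beta> * x2 \<alpha> | \<alpha> \<beta>. True} \<union>
     {x1 \<kappa> * x2 \<alpha> -
        (\<Sum>\<beta>\<in>UNIV. \<Sum>\<mu>\<in>UNIV. R \<kappa> \<alpha> \<beta> \<mu> \<odot>\<^bsub>free_star_algebra\<^esub> (x2 \<beta> * x1 \<mu>)) | \<kappa> \<alpha>. True})"

definition A_R :: "(4 \<Rightarrow> 4 \<Rightarrow> 4 \<Rightarrow> 4 \<Rightarrow> complex) \<Rightarrow> gen free_elem set star_algebra" where
  "A_R R = star_quot free_star_algebra (R_relations R)"

definition A_R_gen :: "(4 \<Rightarrow> 4 \<Rightarrow> 4 \<Rightarrow> 4 \<Rightarrow> complex) \<Rightarrow> gen \<Rightarrow> gen free_elem set" where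
  "A_R_gen R g = star_proj free_star_algebra (R_relations R) (free_gen g)"

definition sq_norm :: "('a, 'm) star_algebra_scheme \<Rightarrow> (4 \<Rightarrow> 'a) \<Rightarrow> 'a" where
  "sq_norm A x = (\<Oplus>\<^bsub>A\<^esub>\<mu>\<in>UNIV. x \<mu> \<otimes>\<^bsub>A\<^esub> x \<mu>)"

definition sphere_relation ::
    "(4 \<Rightarrow> 4 \<Rightarrow> 4 \<Rightarrow> 4 \<Rightarrow> complex) \<Rightarrow> gen free_elem set set" where
  "sphere_relation R =
     {sq_norm (A_R R) (\<lambda>\<kappa>. A_R_gen R (X1 \<kappa>)) \<oplus>\<^bsub>A_R R\<^esub> sq_norm (A_R R) (\<lambda>\<alpha>. A_R_gen R (X2 \<alpha>))
        \<ominus>\<^bsub>A_R R\<^esub> \<one>\<^bsub>A_R R\<^esub>}"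

definition S7 :: "(4 \<Rightarrow> 4 \<Rightarrow> 4 \<Rightarrow> 4 \<Rightarrow> complex) \<Rightarrow> gen free_elem set set star_algebra" where
  "S7 R = star_quot (A_R R) (sphere_relation R)"

definition S7_gen :: "(4 \<Rightarrow> 4 \<Rightarrow> 4 \<Rightarrow> 4 \<Rightarrow> complex) \<Rightarrow> gen \<Rightarrow> gen free_elem set set" where
  "S7_gen R g = star_proj (A_R R) (sphere_relation R) (A_R_gen R g)"


section \<open>Quaternions with entries in a star-algebra\<close>

text \<open>Such a quaternion is the family of its components with respect to
  \<open>e\<^sub>0, e\<^sub>1, e\<^sub>2, e\<^sub>3\<close>.\<close>

definition alg_quat_mult ::
    "('a, 'm) star_algebra_scheme \<Rightarrow> (4 \<Rightarrow> 'a) \<Rightarrow> (4 \<Rightarrow> 'a) \<Rightarrow> 4 \<Rightarrow> 'a" where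
  "alg_quat_mult A p q \<rho> =
     (\<Oplus>\<^bsub>A\<^esub>\<mu>\<in>UNIV. \<Oplus>\<^bsub>A\<^esub>\<nu>\<in>UNIV. complex_of_real (quat_coeff \<mu> \<nu> \<rho>) \<odot>\<^bsub>A\<^esub> (p \<mu> \<otimes>\<^bsub>A\<^esub> q \<nu>))"

definition alg_quat_star :: "('a, 'm) star_algebra_scheme \<Rightarrow> (4 \<Rightarrow> 'a) \<Rightarrow> 4 \<Rightarrow> 'a" where
  "alg_quat_star A p \<mu> = (if \<mu> = 0 then star A (p \<mu>) else \<ominus>\<^bsub>A\<^esub> (star A (p \<mu>)))"

definition Y_elem :: "(4 \<Rightarrow> 4 \<Rightarrow> 4 \<Rightarrow> 4 \<Rightarrow> complex) \<Rightarrow> 4 \<Rightarrow> gen free_elem set set" where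
  "Y_elem R \<mu> = 2 \<odot>\<^bsub>S7 R\<^esub>
     alg_quat_mult (S7 R) (\<lambda>\<alpha>. S7_gen R (X2 \<alpha>))
       (alg_quat_star (S7 R) (\<lambda>\<kappa>. S7_gen R (X1 \<kappa>))) \<mu>"


section \<open>The matrices of the statement\<close>

definition R_u :: "real \<Rightarrow> real \<Rightarrow> real \<Rightarrow> 4 \<Rightarrow> 4 \<Rightarrow> 4 \<Rightarrow> 4 \<Rightarrow> complex" where
  "R_u u0 u1 u2 \<kappa> \<alpha> \<beta> \<mu> =
     complex_of_real u0 * of_bool (\<kappa> = \<mu>) * of_bool (\<alpha> = \<beta>) +
     \<i> * complex_of_real (J_plus 1 $ \<kappa> $ \<mu>) *
         complex_of_real ((u1 *\<^sub>R J_plus 1 + u2 *\<^sub>R J_plus 2) $ \<alpha> $ \<beta>)"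

definition Lambda_u :: "real \<Rightarrow> real \<Rightarrow> real \<Rightarrow> complex^4^4" where
  "Lambda_u u0 u1 u2 = (\<chi> \<mu> \<nu>.
     if (\<mu>, \<nu>) \<in> {(0, 0), (1, 1)} then complex_of_real u0 + \<i> * complex_of_real u1
     else if (\<mu>, \<nu>) \<in> {(3, 3), (2, 2)} then complex_of_real u0 - \<i> * complex_of_real u1
     else if (\<mu>, \<nu>) \<in> {(0, 3), (3, 0), (1, 2), (2, 1)} then \<i> * complex_of_real u2
     else 0)"

definition adjoint_matrix :: "complex^'n^'m \<Rightarrow> complex^'m^'n" where
  "adjoint_matrix M = (\<chi> i j. cnj (M $ j $ i))"

definition unitary_matrix :: "complex^'n^'n \<Rightarrow> bool" where
  "unitary_matrix M \<longleftrightarrow> adjoint_matrix M ** M = mat 1 \<and> M ** adjoint_matrix M = mat 1"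

end

theory Submission
  imports Defs
begin

text \<open>
  The components of \<open>2 x\<^sub>2 x\<^sub>1\<^sup>*\<close> are bilinear forms in \<open>x\<^sub>2\<close>, \<open>x\<^sub>1\<close> with real coefficients:
  \<open>Y\<^sup>0 = 2 x\<^sub>2\<^sup>T x\<^sub>1\<close> and \<open>Y\<^sup>a = 2 x\<^sub>2\<^sup>T J\<^sub>a x\<^sub>1\<close>.  The involution only reverses the order of the generators, and the
  relation for \<open>x\<^sub>1\<^sup>\<kappa> x\<^sub>2\<^sup>\<alpha>\<close> restores it, at the price of contracting the coefficients with \<open>R\<close>.  By
  \<open>J\<^sub>a J\<^sub>b = - \<delta>\<^sub>a\<^sub>b + \<Sum>\<^sub>c \<epsilon>\<^sub>a\<^sub>b\<^sub>c J\<^sub>c\<close>, the span of these four forms is invariant under the contraction, which acts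
  on it by \<open>\<Lambda>\<close>.  Computations are made in the free algebra and pushed to the sphere along the quotient map.
\<close>

section \<open>Star-algebras and their quotients\<close>

text \<open>The record \<open>star_algebra\<close> only carries operations. The axioms stated here
  are identities, so they pass to quotients.\<close>

locale star_alg = ring A for A :: "('a, 'm) star_algebra_scheme" (structure) +
  assumes smult_closed [simp, intro]: "a \<in> carrier A \<Longrightarrow> c \<odot> a \<in> carrier A"
    and smult_r_distr: "\<lbrakk>a \<in> carrier A; b \<in> carrier A\<rbrakk> \<Longrightarrow> c \<odot> (a \<oplus> b) = c \<odot> a \<oplus> c \<odot> b"
    and smult_l_distr: "a \<in> carrier A \<Longrightarrow> (c + d) \<odot> a = c \<odot> a \<oplus> d \<odot> a"
    and smult_assoc: "a \<in> carrier A \<Longrightarrow> (c * d) \<odot> a = c \<odot> (d \<odot> a)"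
    and smult_one: "a \<in> carrier A \<Longrightarrow> 1 \<odot> a = a"
    and smult_mult_left: "\<lbrakk>a \<in> carrier A; b \<in> carrier A\<rbrakk> \<Longrightarrow> (c \<odot> a) \<otimes> b = c \<odot> (a \<otimes> b)"
    and smult_mult_right: "\<lbrakk>a \<in> carrier A; b \<in> carrier A\<rbrakk> \<Longrightarrow> a \<otimes> (c \<odot> b) = c \<odot> (a \<otimes> b)"
    and star_closed [simp, intro]: "a \<in> carrier A \<Longrightarrow> star A a \<in> carrier A"
    and star_star: "a \<in> carrier A \<Longrightarrow> star A (star A a) = a"
    and star_add: "\<lbrakk>a \<in> carrier A; b \<in> carrier A\<rbrakk> \<Longrightarrow> star A (a \<oplus> b) = star A a \<oplus> star A b"
    and star_mult: "\<lbrakk>a \<in> carrier A; b \<in> carrier A\<rbrakk> \<Longrightarrow> star A (a \<otimes> b) = star A b \<otimes> star A a"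
    and star_smult: "a \<in> carrier A \<Longrightarrow> star A (c \<odot> a) = cnj c \<odot> star A a"
begin

lemma star_zero [simp]: "star A \<zero> = \<zero>"
proof -
  have "star A \<zero> \<oplus> star A \<zero> = star A \<zero>"
    by (simp flip: star_add)
  then show ?thesis by (metis r_neg1 l_neg star_closed zero_closed)
qed

lemma star_uminus:
  assumes "a \<in> carrier A"
  shows "star A (\<ominus> a) = \<ominus> star A a"
proof -
  have "star A (\<ominus> a) \<oplus> star A a = \<zero>"
    using assms by (simp add: l_neg flip: star_add)
  then show ?thesis using assms by (simp add: minus_equality)
qed

section \<open>Ideals closed under the involution\<close>

lemma star_ideal_ideal:
  assumes "S \<subseteq> carrier A"
  shows "ideal (star_ideal A S) A"
  unfolding star_ideal_def using assms by (intro genideal_ideal) auto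

lemma star_ideal_superset:
  assumes "S \<subseteq> carrier A"
  shows "S \<subseteq> star_ideal A S"
  unfolding star_ideal_def using genideal_self[of "S \<union> star A ` S"] assms by auto

text \<open>The involution reverses products, so the preimage \<open>?J\<close> of the two-sided
  ideal is again a two-sided ideal. It contains the generators, whose set is closed under adjoints,
  and minimality of the generated ideal concludes.\<close>

lemma star_ideal_star:
  assumes "S \<subseteq> carrier A" and "a \<in> star_ideal A S"
  shows "star A a \<in> star_ideal A S"
proof -
  interpret I: ideal "star_ideal A S" A by (rule star_ideal_ideal[OF assms(1)])
  let ?J = "{a \<in> carrier A. star A a \<in> star_ideal A S}"
  have "subgroup ?J (add_monoid A)"
    by (rule subgroup.intro)
      (auto simp: star_add star_uminus simp flip: a_inv_def)
  then have "ideal ?J A"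
    by (rule idealI[OF ring_axioms]) (auto simp: star_mult I.I_l_closed I.I_r_closed)
  moreover have "S \<union> star A ` S \<subseteq> ?J"
  proof -
    have sub: "S \<union> star A ` S \<subseteq> star_ideal A S"
      unfolding star_ideal_def by (rule genideal_self) (use assms in auto)
    show ?thesis
      using sub assms(1) by (auto simp: star_star subset_iff)
  qed
  ultimately have "star_ideal A S \<subseteq> ?J"
    unfolding star_ideal_def by (rule genideal_minimal)
  then show ?thesis using assms(2) by auto
qed

text \<open>A ring ideal is a complex subspace because scaling by \<open>c\<close> is multiplication
  by \<open>c \<odot> \<one>\<close>.\<close>

lemma star_ideal_smult:
  assumes "S \<subseteq> carrier A" and "a \<in> star_ideal A S"
  shows "c \<odot> a \<in> star_ideal A S"
proof -
  interpret I: ideal "star_ideal A S" A by (rule star_ideal_ideal[OF assms(1)])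
  have "c \<odot> a = (c \<odot> \<one>) \<otimes> a"
    using assms(2) by (simp add: smult_mult_left I.Icarr)
  then show ?thesis
    using assms(2) by (simp add: I.I_l_closed)
qed

end

section \<open>The quotient as a star-algebra\<close>

locale star_alg_quot = star_alg A for A :: "('a, 'm) star_algebra_scheme" (structure) +
  fixes S :: "'a set"
  assumes S_carrier: "S \<subseteq> carrier A"
begin

abbreviation "I \<equiv> star_ideal A S"
abbreviation "Q \<equiv> star_quot A S"
abbreviation "\<pi> \<equiv> star_proj A S"

sublocale I: ideal I A
  by (rule star_ideal_ideal[OF S_carrier])

lemma proj_memD: "\<lbrakk>x \<in> \<pi> a; a \<in> carrier A\<rbrakk> \<Longrightarrow> \<exists>h\<in>I. x = h \<oplus> a"
  by (auto simp: star_proj_def a_r_coset_def')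

lemma carrier_quot: "carrier Q = \<pi> ` carrier A"
  by (auto simp: star_quot_def FactRing_def A_RCOSETS_def' star_proj_def)

lemma proj_closed: "a \<in> carrier A \<Longrightarrow> \<pi> a \<in> carrier Q"
  by (simp add: carrier_quot)

lemma proj_zero: "\<pi> \<zero> = \<zero>\<^bsub>Q\<^esub>"
  by (simp add: star_quot_def FactRing_def star_proj_def I.a_subset)

lemma proj_one: "\<pi> \<one> = \<one>\<^bsub>Q\<^esub>"
  by (simp add: star_quot_def FactRing_def star_proj_def)

lemma proj_add:
  "\<lbrakk>a \<in> carrier A; b \<in> carrier A\<rbrakk> \<Longrightarrow> \<pi> (a \<oplus> b) = \<pi> a \<oplus>\<^bsub>Q\<^esub> \<pi> b"
  by (simp add: star_quot_def FactRing_def star_proj_def I.a_rcos_sum)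

lemma proj_mult:
  "\<lbrakk>a \<in> carrier A; b \<in> carrier A\<rbrakk> \<Longrightarrow> \<pi> (a \<otimes> b) = \<pi> a \<otimes>\<^bsub>Q\<^esub> \<pi> b"
  by (simp add: star_quot_def FactRing_def star_proj_def I.rcoset_mult_add)

lemma proj_smult:
  assumes a: "a \<in> carrier A"
  shows "\<pi> (c \<odot> a) = c \<odot>\<^bsub>Q\<^esub> \<pi> a"
proof -
  have "\<pi> (c \<odot> x) = \<pi> (c \<odot> a)" if x: "x \<in> \<pi> a" for x
  proof -
    obtain h where h: "h \<in> I" "x = h \<oplus> a" using proj_memD[OF x a] by auto
    then have "c \<odot> x = c \<odot> h \<oplus> c \<odot> a" using a by (simp add: smult_r_distr I.Icarr)
    moreover have "c \<odot> h \<in> I" using h star_ideal_smult[OF S_carrier] by simp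
    ultimately have "c \<odot> x \<in> \<pi> (c \<odot> a)" by (auto simp: star_proj_def a_r_coset_def')
    then show ?thesis
      unfolding star_proj_def using a I.a_repr_independence' by (metis smult_closed)
  qed
  then have "(\<Union>x\<in>\<pi> a. \<pi> (c \<odot> x)) = (\<Union>x\<in>\<pi> a. \<pi> (c \<odot> a))"
    by (rule SUP_cong[OF refl])
  \<comment> \<open>The union defining \<open>smult\<close> on cosets now has constant terms; it
    equals that constant only over a nonempty index set.\<close>
  moreover have "\<pi> a \<noteq> {}"
    using I.a_rcos_self[OF a] by (auto simp: star_proj_def)
  ultimately show ?thesis
    by (simp add: star_quot_def star_proj_def)
qed

lemma proj_star:
  assumes a: "a \<in> carrier A"
  shows "\<pi> (star A a) = star Q (\<pi> a)"
proof -
  have img: "star A ` \<pi> b \<subseteq> \<pi> (star A b)" if b: "b \<in> carrier A" for b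
  proof
    fix y assume "y \<in> star A ` \<pi> b"
    then obtain h where "h \<in> I" "y = star A (h \<oplus> b)" using proj_memD[OF _ b] by auto
    then show "y \<in> \<pi> (star A b)"
      using b star_ideal_star[OF S_carrier, of h]
      by (auto simp: star_add I.Icarr star_proj_def a_r_coset_def')
  qed
  \<comment> \<open>The reverse inclusion is \<open>img\<close> at \<open>star A a\<close>, turned
    around by involutivity.\<close>
  have "\<pi> (star A a) \<subseteq> star A ` \<pi> a"
  proof
    fix y assume y: "y \<in> \<pi> (star A a)"
    have "star A y \<in> \<pi> (star A (star A a))" using y img[of "star A a"] a by auto
    moreover have "y \<in> carrier A"
      using proj_memD[OF y] a I.Icarr by auto
    ultimately show "y \<in> star A ` \<pi> a" using a by (metis star_star imageI)
  qed
  then show ?thesis using img[OF a] by (auto simp: star_quot_def)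
qed

lemma proj_eq_zero: "a \<in> S \<Longrightarrow> \<pi> a = \<zero>\<^bsub>Q\<^esub>"
  using star_ideal_superset[OF S_carrier] I.a_rcos_const
  by (auto simp: star_quot_def FactRing_def star_proj_def)

text \<open>Every element of \<open>Q\<close> has the form \<open>\<pi> a\<close>, and the
  homomorphism laws read backwards turn each axiom into the image of the same axiom in
  \<open>A\<close>.\<close>

lemma ring_quot: "ring Q"
proof (rule ringI)
  show "abelian_group Q"
  proof (rule abelian_groupI)
    fix x assume "x \<in> carrier Q"
    then obtain a where a: "a \<in> carrier A" "x = \<pi> a" by (auto simp: carrier_quot)
    have "\<pi> (\<ominus> a) \<oplus>\<^bsub>Q\<^esub> x = \<zero>\<^bsub>Q\<^esub>"
      using a by (simp add: l_neg flip: proj_zero proj_add)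
    then show "\<exists>y\<in>carrier Q. y \<oplus>\<^bsub>Q\<^esub> x = \<zero>\<^bsub>Q\<^esub>"
      using a by (auto intro!: bexI[of _ "\<pi> (\<ominus> a)"] proj_closed)
  qed (auto simp: carrier_quot a_ac simp flip: proj_zero proj_add)
  show "monoid Q"
    by unfold_locales
      (auto simp: carrier_quot m_assoc simp flip: proj_one proj_mult)
qed (auto simp: carrier_quot l_distr r_distr simp flip: proj_add proj_mult)

text \<open>This permits iterated quotients: \<open>S7 R\<close> is a quotient of the quotient
  \<open>A_R R\<close>.\<close>

lemma star_alg_quot: "star_alg Q"
proof -
  interpret Q: ring Q by (rule ring_quot)
  show ?thesis
    by unfold_locales
      (auto simp: carrier_quot smult_r_distr smult_l_distr smult_assoc smult_one smult_mult_left
         smult_mult_right star_star star_add star_mult star_smult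
       simp flip: proj_add proj_mult proj_smult proj_star)
qed

end

section \<open>The coefficient matrices\<close>

lemma index_distinct [simp]: "(0::4) \<noteq> 1" "(0::4) \<noteq> 2" "(0::4) \<noteq> 3" "(1::4) \<noteq> 0" "(1::4) \<noteq> 2" "(1::4) \<noteq> 3"
  "(2::4) \<noteq> 0" "(2::4) \<noteq> 1" "(2::4) \<noteq> 3" "(3::4) \<noteq> 0" "(3::4) \<noteq> 1" "(3::4) \<noteq> 2"
  by simp_all

lemma four_eq_zero: "(4::4) = 0"
  by simp

lemma sum_index: "(\<Sum>i\<in>UNIV. f i) = f 0 + f 1 + f 2 + f (3::4)"
  by (simp add: sum_4 four_eq_zero ac_simps)

lemma forall_index: "(\<forall>i::4. P i) \<longleftrightarrow> P 0 \<and> P 1 \<and> P 2 \<and> P 3"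
  by (auto simp add: forall_4 four_eq_zero)

section \<open>Quaternionic multiplication and the matrices built from it\<close>

lemma quat_coeff_table:
  "quat_coeff 0 \<nu> \<rho> = of_bool (\<rho> = \<nu>)" "quat_coeff \<mu> 0 \<rho> = of_bool (\<rho> = \<mu>)"
  "quat_coeff 1 1 \<rho> = - of_bool (\<rho> = 0)" "quat_coeff 2 2 \<rho> = - of_bool (\<rho> = 0)"
  "quat_coeff 3 3 \<rho> = - of_bool (\<rho> = 0)"
  "quat_coeff 1 2 \<rho> = of_bool (\<rho> = 3)" "quat_coeff 2 1 \<rho> = - of_bool (\<rho> = 3)"
  "quat_coeff 2 3 \<rho> = of_bool (\<rho> = 1)" "quat_coeff 3 2 \<rho> = - of_bool (\<rho> = 1)"
  "quat_coeff 3 1 \<rho> = of_bool (\<rho> = 2)" "quat_coeff 1 3 \<rho> = - of_bool (\<rho> = 2)"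
  by (auto simp: quat_coeff_def eps_def)

text \<open>Column \<open>\<nu>\<close> of left multiplication by \<open>e_a\<close> lists the
  components of \<open>e_a e_\<nu>\<close>.\<close>

lemma J_plus_entry: "J_plus a $ \<rho> $ \<nu> = quat_coeff a \<nu> \<rho>"
  by (simp add: J_plus_def matrix_def quat_mult_def axis_def if_distrib[of "\<lambda>x. _ * x"] cong: if_cong)

text \<open>The coefficient of \<open>x\<^sub>2\<^sup>\<alpha> x\<^sub>1\<^sup>\<kappa>\<close> in \<open>Y\<^sup>\<rho>\<close>; the sign is that of the conjugation in \<open>x\<^sub>1\<^sup>*\<close>.\<close>

definition Y_coeff :: "4 \<Rightarrow> 4 \<Rightarrow> 4 \<Rightarrow> complex" where
  "Y_coeff \<rho> \<alpha> \<kappa> = 2 * complex_of_real (quat_coeff \<alpha> \<kappa> \<rho>) * (if \<kappa> = 0 then 1 else -1)"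

text \<open>As a matrix \<open>M\<close> with row index \<alpha>, \<open>Y_coeff \<rho>\<close> is
  twice the identity for \<open>\<rho> = 0\<close> and \<open>2 J_\<rho>\<close> otherwise. It is
  real, and the \<open>J_a\<close> are antisymmetric, so the contraction is
  \<open>M \<mapsto> u0 M - i (u1 J_1 + u2 J_2) M J_1\<close>. This map preserves the spans of
  \<open>1, J_3\<close> and of \<open>J_1, J_2\<close>, which gives the two blocks of
  \<open>Lambda_u\<close>.\<close>

lemma Y_coeff_R_u:
  "(\<Sum>\<alpha>\<in>UNIV. \<Sum>\<kappa>\<in>UNIV. cnj (Y_coeff \<rho> \<alpha> \<kappa>) * R_u u0 u1 u2 \<kappa> \<alpha> \<beta> \<mu>)
   = (\<Sum>\<nu>\<in>UNIV. Lambda_u u0 u1 u2 $ \<rho> $ \<nu> * Y_coeff \<nu> \<beta> \<mu>)"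
proof -
  \<comment> \<open>Quantified indices let \<open>forall_index\<close> split the identity into 64
    explicit cases.\<close>
  have "\<forall>\<rho> \<beta> \<mu>. (\<Sum>\<alpha>\<in>UNIV. \<Sum>\<kappa>\<in>UNIV. cnj (Y_coeff \<rho> \<alpha> \<kappa>) * R_u u0 u1 u2 \<kappa> \<alpha> \<beta> \<mu>)
      = (\<Sum>\<nu>\<in>UNIV. Lambda_u u0 u1 u2 $ \<rho> $ \<nu> * Y_coeff \<nu> \<beta> \<mu>)"
    by (simp add: forall_index sum_index R_u_def J_plus_entry Lambda_u_def Y_coeff_def
        quat_coeff_table algebra_simps)
  then show ?thesis by blast
qed

lemma Lambda_symmetric: "transpose (Lambda_u u0 u1 u2) = Lambda_u u0 u1 u2"
  by (simp add: vec_eq_iff transpose_def Lambda_u_def forall_index)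

text \<open>Both blocks have rows of squared length \<open>u0^2 + u1^2 + u2^2\<close>; the rows are
  orthogonal since the diagonal entries are conjugate and the off-diagonal one is imaginary.\<close>

lemma Lambda_unitary:
  assumes "u0\<^sup>2 + u1\<^sup>2 + u2\<^sup>2 = 1"
  shows "unitary_matrix (Lambda_u u0 u1 u2)"
proof -
  have "u0 * u0 + (u1 * u1 + u2 * u2) = 1"
    using assms by (simp add: power2_eq_square)
  then have "complex_of_real u0 * u0 + (complex_of_real u1 * u1 + complex_of_real u2 * u2) = 1"
    by (metis of_real_1 of_real_add of_real_mult)
  then show ?thesis
    by (simp add: unitary_matrix_def vec_eq_iff adjoint_matrix_def matrix_matrix_mult_def mat_def
        Lambda_u_def forall_index sum_index algebra_simps)
qed

section \<open>The free star-algebra\<close>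

lemma free_star_algebra_simps:
  "carrier free_star_algebra = UNIV" "mult free_star_algebra = (*)" "one free_star_algebra = 1"
  "zero free_star_algebra = 0" "add free_star_algebra = (+)"
  by (simp_all add: free_star_algebra_def)

lemma word_rev_word_rev [simp]: "word_rev (word_rev w) = w"
  by (simp add: word_rev_def)

lemma inj_word_rev: "inj word_rev"
  by (metis injI word_rev_word_rev)

lemma word_rev_zero [simp]: "word_rev 0 = 0"
  by (simp add: word_rev_def zero_word_def)

lemma word_rev_plus: "word_rev (v + w) = word_rev w + word_rev v"
  by (simp add: word_rev_def plus_word_def)

text \<open>\<open>map_key\<close> is precomposition for injective key maps, hence the appeal to
  \<open>inj_word_rev\<close>.\<close>

lemma lookup_free_star:
  "Poly_Mapping.lookup (star free_star_algebra f) w = cnj (Poly_Mapping.lookup f (word_rev w))"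
  by (simp add: free_star_algebra_def Poly_Mapping.map.rep_eq map_key.rep_eq[OF inj_word_rev] when_def)

text \<open>Writing a scalar as a constant on the empty word reduces most scalar laws to ring
  laws.\<close>

definition free_scale :: "complex \<Rightarrow> 'g free_elem \<Rightarrow> 'g free_elem" where
  "free_scale c f = Poly_Mapping.single 0 c * f"

lemma free_smult: "c \<odot>\<^bsub>free_star_algebra\<^esub> f = free_scale c f"
  by (simp add: free_scale_def free_star_algebra_def mult_map_scale_conv_mult)

lemma free_scale_add_left: "free_scale (c + d) f = free_scale c f + free_scale d f"
  by (simp add: free_scale_def single_add distrib_right)

lemma free_scale_add_right: "free_scale c (f + g) = free_scale c f + free_scale c g"
  by (simp add: free_scale_def distrib_left)

lemma free_scale_zero [simp]: "free_scale 0 f = 0"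
  by (simp add: free_scale_def)

lemma free_scale_one [simp]: "free_scale 1 f = f"
  by (simp add: free_scale_def)

lemma free_scale_scale: "free_scale c (free_scale d f) = free_scale (c * d) f"
  by (simp add: free_scale_def mult_single flip: mult.assoc)

lemma free_scale_uminus_one: "free_scale (- 1) f = - f"
  by (simp add: free_scale_def single_uminus)

lemma free_scale_mult_left: "free_scale c f * g = free_scale c (f * g)"
  by (simp add: free_scale_def mult.assoc)

lemma free_scale_sum_left: "free_scale (\<Sum>i\<in>I. c i) f = (\<Sum>i\<in>I. free_scale (c i) f)"
  by (induction I rule: infinite_finite_induct) (simp_all add: free_scale_add_left)

lemma free_scale_sum_right: "free_scale c (\<Sum>i\<in>I. f i) = (\<Sum>i\<in>I. free_scale c (f i))"
  by (simp add: free_scale_def sum_distrib_left)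

section \<open>The involution of the free algebra\<close>

lemma free_star_plus:
  "star free_star_algebra (f + g) = star free_star_algebra f + star free_star_algebra g"
  by (rule poly_mapping_eqI) (simp add: lookup_free_star lookup_add)

lemma free_star_zero: "star free_star_algebra 0 = 0"
  by (rule poly_mapping_eqI) (simp add: lookup_free_star)

lemma free_star_single:
  "star free_star_algebra (Poly_Mapping.single w c) = Poly_Mapping.single (word_rev w) (cnj c)"
  by (rule poly_mapping_eqI) (auto simp: lookup_free_star lookup_single when_def)

text \<open>Updating at a fresh key is adding a monomial. Additive identities thereby reduce to
  single words.\<close>

lemma poly_mapping_single_induct [case_names zero plus]:
  fixes f :: "'a \<Rightarrow>\<^sub>0 'b::monoid_add"
  assumes "P 0" and "\<And>a b f. P f \<Longrightarrow> P (f + Poly_Mapping.single a b)"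
  shows "P f"
proof (induction f rule: Poly_Mapping.update_induct)
  case (update f a b)
  have "Poly_Mapping.update a b f = f + Poly_Mapping.single a b"
    using update(1)
    by (intro poly_mapping_eqI) (auto simp: lookup_update lookup_add lookup_single in_keys_iff)
  then show ?case using assms(2) update by simp
qed (rule assms(1))

text \<open>Both sides are additive in each factor, so nested inductions reduce the claim to two
  monomials, where it is \<open>word_rev_plus\<close>.\<close>

lemma free_star_times:
  "star free_star_algebra (f * g) = star free_star_algebra g * star free_star_algebra f"
proof (induction f rule: poly_mapping_single_induct)
  case (plus v b f)
  have "star free_star_algebra (Poly_Mapping.single v b * g)
      = star free_star_algebra g * star free_star_algebra (Poly_Mapping.single v b)"
    by (induction g rule: poly_mapping_single_induct)
      (simp_all add: distrib_left distrib_right free_star_plus free_star_zero free_star_single mult_single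
        word_rev_plus mult.commute)
  then show ?case using plus by (simp add: distrib_left distrib_right free_star_plus)
qed (simp add: free_star_zero)

text \<open>Constants on the empty word are central, as is seen on monomials.\<close>

lemma free_scale_mult_right: "f * free_scale c g = free_scale c (f * g)"
proof -
  have "f * Poly_Mapping.single 0 c = Poly_Mapping.single 0 c * f"
    by (induction f rule: poly_mapping_single_induct)
      (simp_all add: distrib_left distrib_right mult_single mult.commute)
  then show ?thesis
    by (simp add: free_scale_def flip: mult.assoc)
qed

lemma free_star_scale:
  "star free_star_algebra (free_scale c f) = free_scale (cnj c) (star free_star_algebra f)"
  \<comment> \<open>The involution moves the constant to the right of
    \<open>star free_star_algebra f\<close>; centrality, taken with second factor \<open>1\<close>,
    brings it back.\<close>
  using free_scale_mult_right[of "star free_star_algebra f" "cnj c" 1]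
  by (simp add: free_scale_def free_star_times free_star_single)

lemma star_alg_free: "star_alg (free_star_algebra :: 'g free_elem star_algebra)"
proof -
  let ?F = "free_star_algebra :: 'g free_elem star_algebra"
  interpret ring ?F
  proof (rule ringI)
    show "abelian_group ?F"
    proof (rule abelian_groupI)
      fix f assume "f \<in> carrier ?F"
      show "\<exists>g\<in>carrier ?F. g \<oplus>\<^bsub>?F\<^esub> f = \<zero>\<^bsub>?F\<^esub>"
        by (rule bexI[of _ "- f"]) (simp_all add: free_star_algebra_simps)
    qed (simp_all add: free_star_algebra_simps ac_simps)
    show "monoid ?F"
      by unfold_locales (simp_all add: free_star_algebra_simps mult.assoc)
  qed (simp_all add: free_star_algebra_simps algebra_simps)
  show ?thesis
  proof unfold_locales
    show "star ?F (star ?F f) = f" for f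
      by (rule poly_mapping_eqI) (simp add: lookup_free_star)
  qed (simp_all add: free_star_algebra_simps free_smult free_scale_add_left free_scale_add_right free_scale_scale
      free_scale_mult_left free_scale_mult_right free_star_plus free_star_times free_star_scale)
qed

lemma free_star_gen: "star free_star_algebra (free_gen g) = free_gen g"
  by (simp add: free_gen_def free_star_single word_rev_def)

section \<open>The noncommutative seven-sphere\<close>

text \<open>The free algebra occupies a whole type, so computations there use ordinary sums and
  products; \<open>\<phi>\<close> transfers the results to the carrier-based operations of
  \<open>B\<close>.\<close>

locale free_hom = star_alg B for B :: "('b, 'm) star_algebra_scheme" (structure) +
  fixes \<phi> :: "'g free_elem \<Rightarrow> 'b"
  assumes hom_closed [simp, intro]: "\<phi> f \<in> carrier B"
    and hom_zero: "\<phi> 0 = \<zero>"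
    and hom_add: "\<phi> (f + g) = \<phi> f \<oplus> \<phi> g"
    and hom_mult: "\<phi> (f * g) = \<phi> f \<otimes> \<phi> g"
    and hom_smult: "\<phi> (free_scale c f) = c \<odot> \<phi> f"
    and hom_star: "\<phi> (star free_star_algebra f) = star B (\<phi> f)"
begin

lemma hom_uminus: "\<phi> (- f) = \<ominus> \<phi> f"
proof -
  have "\<phi> (- f) \<oplus> \<phi> f = \<zero>"
    by (simp add: hom_zero flip: hom_add)
  then show ?thesis by (simp add: minus_equality)
qed

lemma hom_sum: "finite I \<Longrightarrow> \<phi> (\<Sum>i\<in>I. f i) = (\<Oplus>i\<in>I. \<phi> (f i))"
  by (induction I rule: finite_induct) (simp_all add: hom_zero hom_add)

text \<open>Permits rewriting modulo the kernel of \<open>\<phi>\<close> inside a sum.\<close>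

lemma hom_sum_cong:
  assumes "finite I" and "\<And>i. i \<in> I \<Longrightarrow> \<phi> (f i) = \<phi> (g i)"
  shows "\<phi> (\<Sum>i\<in>I. f i) = \<phi> (\<Sum>i\<in>I. g i)"
  unfolding hom_sum[OF assms(1)] using assms by (intro finsum_cong') auto

end

section \<open>The projection onto the sphere\<close>

definition S7_proj :: "(4 \<Rightarrow> 4 \<Rightarrow> 4 \<Rightarrow> 4 \<Rightarrow> complex) \<Rightarrow> gen free_elem \<Rightarrow> gen free_elem set set" where
  "S7_proj R f = star_proj (A_R R) (sphere_relation R) (star_proj free_star_algebra (R_relations R) f)"

lemma A_R_quot: "star_alg_quot free_star_algebra (R_relations R)"
  by (intro star_alg_quot.intro star_alg_quot_axioms.intro star_alg_free)
    (simp add: free_star_algebra_simps)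

lemma S7_quot: "star_alg_quot (A_R R) (sphere_relation R)"
proof -
  interpret P: star_alg_quot free_star_algebra "R_relations R" by (rule A_R_quot)
  interpret A: star_alg "A_R R" unfolding A_R_def by (rule P.star_alg_quot)
  have "A_R_gen R g \<in> carrier (A_R R)" for g
    unfolding A_R_gen_def A_R_def by (rule P.proj_closed) (simp add: free_star_algebra_simps)
  then have "sphere_relation R \<subseteq> carrier (A_R R)"
    unfolding sphere_relation_def sq_norm_def by auto
  then show ?thesis
    by (intro star_alg_quot.intro star_alg_quot_axioms.intro A.star_alg_axioms)
qed

lemma S7_hom: "free_hom (S7 R) (S7_proj R)"
proof -
  interpret P: star_alg_quot free_star_algebra "R_relations R" by (rule A_R_quot)
  interpret A: star_alg_quot "A_R R" "sphere_relation R" by (rule S7_quot)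
  interpret S: star_alg "S7 R" unfolding S7_def by (rule A.star_alg_quot)
  have carrier: "star_proj free_star_algebra (R_relations R) f \<in> carrier (A_R R)" for f
    unfolding A_R_def by (rule P.proj_closed) (simp add: free_star_algebra_simps)
  note P_hom = P.proj_zero P.proj_add P.proj_mult P.proj_smult P.proj_star
  \<comment> \<open>The laws of the first projection are restated with the type class operations and
    with \<open>A_R R\<close> as target, ready to be composed with the second.\<close>
  note P_hom' = P_hom[unfolded free_star_algebra_simps free_smult, folded A_R_def, simplified]
  show ?thesis
    by unfold_locales
      (simp_all add: S7_proj_def S7_def P_hom' carrier A.proj_closed A.proj_zero A.proj_add
        A.proj_mult A.proj_smult A.proj_star)
qed

lemma S7_proj_gen: "S7_proj R (free_gen g) = S7_gen R g"
  by (simp add: S7_proj_def S7_gen_def A_R_gen_def)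

lemma S7_proj_R_relation:
  "S7_proj R (free_gen (X1 \<kappa>) * free_gen (X2 \<alpha>)) =
   S7_proj R (\<Sum>\<beta>\<in>UNIV. \<Sum>\<mu>\<in>UNIV.
     free_scale (R \<kappa> \<alpha> \<beta> \<mu>) (free_gen (X2 \<beta>) * free_gen (X1 \<mu>)))"
  (is "S7_proj R ?l = S7_proj R ?r")
proof -
  interpret P: star_alg_quot free_star_algebra "R_relations R" by (rule A_R_quot)
  interpret A: star_alg_quot "A_R R" "sphere_relation R" by (rule S7_quot)
  interpret free_hom "S7 R" "S7_proj R" by (rule S7_hom)
  \<comment> \<open>The difference is a generator of the first ideal; the second projection
    preserves zero.\<close>
  have "?l - ?r \<in> R_relations R"
    unfolding R_relations_def Let_def free_smult by blast
  then have "star_proj free_star_algebra (R_relations R) (?l - ?r) = \<zero>\<^bsub>A_R R\<^esub>"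
    unfolding A_R_def by (rule P.proj_eq_zero)
  then have "S7_proj R (?l - ?r) = \<zero>\<^bsub>S7 R\<^esub>"
    using A.proj_zero by (simp add: S7_proj_def S7_def)
  then show ?thesis
    using hom_add[of "?l - ?r" ?r] by simp
qed

section \<open>Bilinear forms with the \<open>X2\<close> generators on the left\<close>

definition bilinear_21 :: "(4 \<Rightarrow> 4 \<Rightarrow> complex) \<Rightarrow> gen free_elem" where
  "bilinear_21 M = (\<Sum>\<alpha>\<in>UNIV. \<Sum>\<kappa>\<in>UNIV.
     free_scale (M \<alpha> \<kappa>) (free_gen (X2 \<alpha>) * free_gen (X1 \<kappa>)))"

text \<open>The generators stay hermitian in the sphere, so quaternionic conjugation of
  \<open>x_1\<close> only changes the signs of its imaginary components; \<open>Y_coeff\<close>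
  absorbs these signs and the factor 2.\<close>

lemma Y_elem_eq: "Y_elem R \<rho> = S7_proj R (bilinear_21 (Y_coeff \<rho>))"
proof -
  interpret free_hom "S7 R" "S7_proj R" by (rule S7_hom)
  have star_gen: "star (S7 R) (S7_gen R g) = S7_gen R g" for g
    by (metis S7_proj_gen free_star_gen hom_star)
  have "alg_quat_star (S7 R) (\<lambda>\<kappa>. S7_gen R (X1 \<kappa>)) \<kappa>
      = S7_proj R (free_scale (if \<kappa> = 0 then 1 else -1) (free_gen (X1 \<kappa>)))" for \<kappa>
    by (simp add: alg_quat_star_def star_gen free_scale_uminus_one hom_uminus S7_proj_gen)
  then have "Y_elem R \<rho> = S7_proj R (free_scale 2 (\<Sum>\<alpha>\<in>UNIV. \<Sum>\<kappa>\<in>UNIV.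
      free_scale (quat_coeff \<alpha> \<kappa> \<rho>)
        (free_gen (X2 \<alpha>) * free_scale (if \<kappa> = 0 then 1 else -1) (free_gen (X1 \<kappa>)))))"
    by (simp add: Y_elem_def alg_quat_mult_def hom_smult hom_sum hom_mult S7_proj_gen)
  also have "\<dots> = S7_proj R (bilinear_21 (Y_coeff \<rho>))"
    by (simp add: bilinear_21_def Y_coeff_def free_scale_sum_right free_scale_mult_right free_scale_scale mult.assoc)
  finally show ?thesis .
qed

text \<open>The involution conjugates the coefficients and puts \<open>X1\<close> first; the
  \<open>R\<close> relation then restores the order.\<close>

lemma S7_proj_star_bilinear:
  "S7_proj R (star free_star_algebra (bilinear_21 M))
   = S7_proj R (bilinear_21 (\<lambda>\<beta> \<mu>. \<Sum>\<alpha>\<in>UNIV. \<Sum>\<kappa>\<in>UNIV. cnj (M \<alpha> \<kappa>) * R \<kappa> \<alpha> \<beta> \<mu>))"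
proof -
  interpret free_hom "S7 R" "S7_proj R" by (rule S7_hom)
  have free_star_sum: "star free_star_algebra (\<Sum>i\<in>I. f i) = (\<Sum>i\<in>I. star free_star_algebra (f i))"
    for f :: "4 \<Rightarrow> gen free_elem" and I
    by (induction I rule: infinite_finite_induct) (simp_all add: free_star_zero free_star_plus)
  have "S7_proj R (star free_star_algebra (bilinear_21 M))
      = S7_proj R (\<Sum>\<alpha>\<in>UNIV. \<Sum>\<kappa>\<in>UNIV.
          free_scale (cnj (M \<alpha> \<kappa>)) (free_gen (X1 \<kappa>) * free_gen (X2 \<alpha>)))"
    by (simp add: bilinear_21_def free_star_sum free_star_scale free_star_times free_star_gen)
  also have "\<dots> = S7_proj R (\<Sum>\<alpha>\<in>UNIV. \<Sum>\<kappa>\<in>UNIV. free_scale (cnj (M \<alpha> \<kappa>))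
      (\<Sum>\<beta>\<in>UNIV. \<Sum>\<mu>\<in>UNIV. free_scale (R \<kappa> \<alpha> \<beta> \<mu>) (free_gen (X2 \<beta>) * free_gen (X1 \<mu>))))"
    by (intro hom_sum_cong finite) (simp add: hom_smult S7_proj_R_relation)
  \<comment> \<open>Regrouping by the monomials with indices \<open>\<beta>\<close>,
    \<open>\<mu>\<close>: first \<open>\<kappa>\<close> moves inwards past both, then
    \<open>\<alpha>\<close> does.\<close>
  also have "(\<Sum>\<alpha>\<in>UNIV. \<Sum>\<kappa>\<in>UNIV. free_scale (cnj (M \<alpha> \<kappa>))
      (\<Sum>\<beta>\<in>UNIV. \<Sum>\<mu>\<in>UNIV. free_scale (R \<kappa> \<alpha> \<beta> \<mu>) (free_gen (X2 \<beta>) * free_gen (X1 \<mu>))))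
    = (\<Sum>\<alpha>\<in>UNIV. \<Sum>\<beta>\<in>UNIV. \<Sum>\<mu>\<in>UNIV. \<Sum>\<kappa>\<in>UNIV.
        free_scale (cnj (M \<alpha> \<kappa>) * R \<kappa> \<alpha> \<beta> \<mu>) (free_gen (X2 \<beta>) * free_gen (X1 \<mu>)))"
    unfolding free_scale_sum_right free_scale_scale
    by (rule sum.cong[OF refl], rule trans[OF sum.swap], rule sum.cong[OF refl], rule sum.swap)
  also have "\<dots> = bilinear_21 (\<lambda>\<beta> \<mu>. \<Sum>\<alpha>\<in>UNIV. \<Sum>\<kappa>\<in>UNIV. cnj (M \<alpha> \<kappa>) * R \<kappa> \<alpha> \<beta> \<mu>)"
    unfolding bilinear_21_def free_scale_sum_left
    by (rule trans[OF sum.swap], rule sum.cong[OF refl], rule sum.swap)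
  finally show ?thesis .
qed

text \<open>The right side stays the image of one sum in the free algebra, from which both the
  general formula and the explicit rows can be read off.\<close>

lemma star_Y_elem:
  fixes u0 u1 u2 :: real
  defines "R \<equiv> R_u u0 u1 u2"
  shows "star (S7 R) (Y_elem R \<rho>)
    = S7_proj R (\<Sum>\<nu>\<in>UNIV. free_scale (Lambda_u u0 u1 u2 $ \<rho> $ \<nu>) (bilinear_21 (Y_coeff \<nu>)))"
proof -
  interpret free_hom "S7 R" "S7_proj R" by (rule S7_hom)
  have "star (S7 R) (Y_elem R \<rho>)
      = S7_proj R (bilinear_21 (\<lambda>\<beta> \<mu>. \<Sum>\<nu>\<in>UNIV. Lambda_u u0 u1 u2 $ \<rho> $ \<nu> * Y_coeff \<nu> \<beta> \<mu>))"
    unfolding Y_elem_eq hom_star[symmetric] S7_proj_star_bilinear by (simp add: R_def Y_coeff_R_u)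
  also have "bilinear_21 (\<lambda>\<beta> \<mu>. \<Sum>\<nu>\<in>UNIV. Lambda_u u0 u1 u2 $ \<rho> $ \<nu> * Y_coeff \<nu> \<beta> \<mu>)
      = (\<Sum>\<nu>\<in>UNIV. free_scale (Lambda_u u0 u1 u2 $ \<rho> $ \<nu>) (bilinear_21 (Y_coeff \<nu>)))"
    unfolding bilinear_21_def free_scale_sum_left free_scale_sum_right free_scale_scale
    by (rule sym, rule trans[OF sum.swap], rule sum.cong[OF refl], rule sum.swap)
  finally show ?thesis .
qed

theorem proposition4p1:
  fixes u0 u1 u2 :: real
  assumes "u0\<^sup>2 + u1\<^sup>2 + u2\<^sup>2 = 1"
  shows "let A = S7 (R_u u0 u1 u2); Y = Y_elem (R_u u0 u1 u2); \<Lambda> = Lambda_u u0 u1 u2 in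
    (\<forall>\<mu>. star A (Y \<mu>) = (\<Oplus>\<^bsub>A\<^esub>\<nu>\<in>UNIV. (\<Lambda> $ \<mu> $ \<nu>) \<odot>\<^bsub>A\<^esub> Y \<nu>)) \<and>
    transpose \<Lambda> = \<Lambda> \<and> unitary_matrix \<Lambda> \<and>
    star A (Y 0) = (u0 + \<i> * u1) \<odot>\<^bsub>A\<^esub> Y 0 \<oplus>\<^bsub>A\<^esub> (\<i> * u2) \<odot>\<^bsub>A\<^esub> Y 3 \<and>
    star A (Y 3) = (\<i> * u2) \<odot>\<^bsub>A\<^esub> Y 0 \<oplus>\<^bsub>A\<^esub> (u0 - \<i> * u1) \<odot>\<^bsub>A\<^esub> Y 3 \<and>
    star A (Y 1) = (u0 + \<i> * u1) \<odot>\<^bsub>A\<^esub> Y 1 \<oplus>\<^bsub>A\<^esub> (\<i> * u2) \<odot>\<^bsub>A\<^esub> Y 2 \<and>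
    star A (Y 2) = (\<i> * u2) \<odot>\<^bsub>A\<^esub> Y 1 \<oplus>\<^bsub>A\<^esub> (u0 - \<i> * u1) \<odot>\<^bsub>A\<^esub> Y 2"
proof -
  let ?R = "R_u u0 u1 u2"
  interpret free_hom "S7 ?R" "S7_proj ?R" by (rule S7_hom)
  have "star (S7 ?R) (Y_elem ?R \<mu>)
      = (\<Oplus>\<^bsub>S7 ?R\<^esub>\<nu>\<in>UNIV. (Lambda_u u0 u1 u2 $ \<mu> $ \<nu>) \<odot>\<^bsub>S7 ?R\<^esub> Y_elem ?R \<nu>)" for \<mu>
    unfolding star_Y_elem by (simp add: hom_sum hom_smult Y_elem_eq)
  moreover have
    "star (S7 ?R) (Y_elem ?R 0) = (u0 + \<i> * u1) \<odot>\<^bsub>S7 ?R\<^esub> Y_elem ?R 0 \<oplus>\<^bsub>S7 ?R\<^esub> (\<i> * u2) \<odot>\<^bsub>S7 ?R\<^esub> Y_elem ?R 3"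
    "star (S7 ?R) (Y_elem ?R 3) = (\<i> * u2) \<odot>\<^bsub>S7 ?R\<^esub> Y_elem ?R 0 \<oplus>\<^bsub>S7 ?R\<^esub> (u0 - \<i> * u1) \<odot>\<^bsub>S7 ?R\<^esub> Y_elem ?R 3"
    "star (S7 ?R) (Y_elem ?R 1) = (u0 + \<i> * u1) \<odot>\<^bsub>S7 ?R\<^esub> Y_elem ?R 1 \<oplus>\<^bsub>S7 ?R\<^esub> (\<i> * u2) \<odot>\<^bsub>S7 ?R\<^esub> Y_elem ?R 2"
    "star (S7 ?R) (Y_elem ?R 2) = (\<i> * u2) \<odot>\<^bsub>S7 ?R\<^esub> Y_elem ?R 1 \<oplus>\<^bsub>S7 ?R\<^esub> (u0 - \<i> * u1) \<odot>\<^bsub>S7 ?R\<^esub> Y_elem ?R 2"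
    \<comment> \<open>Expanding before projecting makes the zero entries of \<open>Lambda_u\<close>
      vanish in the free algebra, so each row keeps two terms.\<close>
    unfolding star_Y_elem sum_index
    by (simp_all add: Lambda_u_def hom_add hom_smult Y_elem_eq)
  ultimately show ?thesis
    using Lambda_symmetric Lambda_unitary[OF assms] by (simp add: Let_def)
qed

end
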